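(* For $n\in\mathbb{N}_{+}$ let $$F_n(x,y,z)=(x+y+z)^{2n+1}+(-x+z-y)^{2n+1}+(x-y-z)^{2n+1}+(-x+y-z)^{2n+1}\in\mathbb{Z}[x,y,z].$$ Then for every $n\in\mathbb{N}_{+}$ and every prime $p$, $$\phi_p(F_n)=\begin{cases}\nu_2(n)+3, & \text{if } p=2,\\ 1, & \text{if } p>2 \text{ and } 2n+1=p^m \text{ for some } m\in\mathbb{N}_{+},\\ 0, & \text{otherwise}.\end{cases}$$ Moreover, $F_n(x,y,z)\equiv 0 \pmod{xyz}$, i.e. $xyz$ divides $F_n$ in $\mathbb{Z}[x,y,z]$.
   Context: For a prime $p$, $\nu_p$ denotes the usual $p$-adic valuation on integers. For a nonzero polynomial $F=\sum_\alpha a_\alpha \overline{X}^\alpha\in\mathbb{Z}[x_1,\dots,x_k]$, $\phi_p(F)=\min\{\nu_p(a_\alpha): a_\alpha\neq 0\}$, i.e. the largest $k\in\mathbb{N}$ such that $p^k$ divides every coefficient of $F$ (and $\phi_p(0)=\infty$). *)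

theory Defs
  imports
    "HOL-Computational_Algebra.Primes"
    "HOL-Library.Poly_Mapping"
    "HOL-Library.Extended_Nat"
begin

text \<open>
  A polynomial over the coefficient ring \<open>'a\<close> in commuting indeterminates indexed by \<open>'v\<close> is a
  finitely supported map from exponent vectors to coefficients; multiplication on
  \<open>\<Rightarrow>\<^sub>0\<close> is convolution, so this is the polynomial ring.
\<close>
type_synonym ('v, 'a) mpoly = "('v \<Rightarrow>\<^sub>0 nat) \<Rightarrow>\<^sub>0 'a"

definition indet :: "'v \<Rightarrow> ('v, 'a::zero_neq_one) mpoly" where
  "indet v = Poly_Mapping.single (Poly_Mapping.single v 1) 1"

definition phi :: "nat \<Rightarrow> ('v, int) mpoly \<Rightarrow> enat" where
  "phi p F =
     (if F = 0 then \<infinity>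
      else enat (Min ((\<lambda>\<alpha>. multiplicity (int p) (Poly_Mapping.lookup F \<alpha>)) ` Poly_Mapping.keys F)))"

text \<open>The three indices are a type of their own, so that \<open>(xyz, int) mpoly\<close> is exactly
  \<open>\<int>[x,y,z]\<close>, without further indeterminates.\<close>
datatype xyz = Ix | Iy | Iz

abbreviation (input) Xv :: "(xyz, int) mpoly" where "Xv \<equiv> indet Ix"
abbreviation (input) Yv :: "(xyz, int) mpoly" where "Yv \<equiv> indet Iy"
abbreviation (input) Zv :: "(xyz, int) mpoly" where "Zv \<equiv> indet Iz"

definition Fpoly :: "nat \<Rightarrow> (xyz, int) mpoly" where
  "Fpoly n =
     (Xv + Yv + Zv) ^ (2 * n + 1) + (- Xv + Zv - Yv) ^ (2 * n + 1) +
     (Xv - Yv - Zv) ^ (2 * n + 1) + (- Xv + Yv - Zv) ^ (2 * n + 1)"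

end

theory Submission imports Defs "HOL-Algebra.Exponent" begin

(* Expanding the four powers, the coefficient of x^a y^b z^c with a + b + c = 2n + 1 is the trinomial
   coefficient times 1 + (-1)^(a+b) + (-1)^(b+c) + (-1)^(a+c). This factor is 4 if a, b, c are all odd
   and 0 otherwise, so xyz divides F_n and phi_p(F_n) is the least valuation of 4 (2n+1)!/(a! b! c!)
   over odd a, b, c.
   For p = 2, a b (2n+1)!/(a! b! c!) is a multiple of 2n, with a and b odd, and a = b = 1 is extremal.
   For odd p, subtract from 2n + 1 the largest power p^i dividing it, and then from the rest, if it is
   nonzero, the largest power p^j dividing that: the choice (a, b) = (p^i, p^j) gives a trinomial
   coefficient prime to p. The rest vanishes exactly if 2n + 1 is a power p^m; then
   a = b = p^(m-1) gives valuation 1, and p divides every binomial coefficient of p^m over a with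
   0 < a < p^m. *)

section \<open>Expansion of the four powers in a commutative ring\<close>

text \<open>The product form lets each binomial factor be treated separately modulo a prime.\<close>

definition trinomial :: "nat \<Rightarrow> nat \<Rightarrow> nat \<Rightarrow> nat" where
  "trinomial N a b = (N choose a) * ((N - a) choose b)"

text \<open>Two exponents suffice: for odd \<open>N\<close> the third one, \<open>N - a - b\<close>,
  is then odd as well.\<close>

definition odd_pairs :: "nat \<Rightarrow> (nat \<times> nat) set" where
  "odd_pairs N = {(a, b). odd a \<and> odd b \<and> a + b \<le> N}"

lemma trinomial_expansion:
  fixes x y z :: "'a::comm_ring_1"
  shows "(x + y + z) ^ N =
    (\<Sum>(a, b)\<in>(SIGMA a:{..N}. {..N - a}). of_nat (trinomial N a b) * (x ^ a * y ^ b * z ^ (N - a - b)))"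
proof -
  have "(x + y + z) ^ N = (x + (y + z)) ^ N"
    by (simp add: add.assoc)
  also have "\<dots> = (\<Sum>a\<le>N. \<Sum>b\<le>N - a.
      of_nat (trinomial N a b) * (x ^ a * y ^ b * z ^ (N - a - b)))"
    by (simp add: binomial_ring[of x "y + z"] binomial_ring[of y z] trinomial_def sum_distrib_left ac_simps)
  finally show ?thesis
    by (simp add: sum.Sigma)
qed

lemma four_powers_expansion:
  fixes x y z :: "'a::comm_ring_1"
  assumes "odd N"
  shows "(x + y + z) ^ N + (- x + z - y) ^ N + (x - y - z) ^ N + (- x + y - z) ^ N =
    (\<Sum>(a, b)\<in>odd_pairs N. of_nat (4 * trinomial N a b) * (x ^ a * y ^ b * z ^ (N - a - b)))"
proof -
  let ?T = "SIGMA a:{..N}. {..N - a}"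
  let ?m = "\<lambda>a b. x ^ a * y ^ b * z ^ (N - a - b)"
  \<comment> \<open>In each of the last three powers exactly two of the variables carry a minus
    sign: x and y, then y and z, then x and z.\<close>
  let ?s = "\<lambda>a b. 1 + (-1) ^ (a + b) + (-1) ^ (b + (N - a - b)) + (-1) ^ (a + (N - a - b)) :: 'a"
  have sign: "?s a b = (if odd a \<and> odd b then 4 else 0)" if "a \<le> N" "b \<le> N - a" for a b
  proof -
    \<comment> \<open>The exponents have odd sum, so one or all three are odd. If only one is, two
      of the three pair sums are odd and the signs cancel; if all are, every sign is +1.\<close>
    have "N = a + b + (N - a - b)"
      using that by simp
    then have "odd (a + b + (N - a - b))"
      using assms by simp
    then show ?thesis
      by (auto simp: minus_one_power_iff)
  qed
  \<comment> \<open>Here \<open>t\<close> stands for the trinomial coefficient and \<open>r\<close>,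
    \<open>s\<close>, \<open>u\<close> for the powers of -1 split off from those of x, y, z.\<close>
  have collect: "t * (X * Y * Z) + t * (r * X * (s * Y) * Z) + t * (X * (s * Y) * (u * Z)) +
      t * (r * X * Y * (u * Z)) = t * ((1 + r * s + s * u + r * u) * (X * Y * Z))"
    for t r s u X Y Z :: 'a
    by (simp add: algebra_simps)
  have "(x + y + z) ^ N + (- x + z - y) ^ N + (x - y - z) ^ N + (- x + y - z) ^ N =
    (x + y + z) ^ N + (- x + - y + z) ^ N + (x + - y + - z) ^ N + (- x + y + - z) ^ N"
    by (simp add: algebra_simps)
  also have "\<dots> = (\<Sum>(a, b)\<in>?T. of_nat (trinomial N a b) * (?s a b * ?m a b))"
    unfolding trinomial_expansion sum.distrib[symmetric]
      case_prod_unfold power_add power_minus[of x] power_minus[of y] power_minus[of z]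
    by (simp only: collect)
  also have "\<dots> = (\<Sum>(a, b)\<in>?T. if odd a \<and> odd b then of_nat (4 * trinomial N a b) * ?m a b else 0)"
  proof (intro sum.cong refl, clarify)
    fix a b
    assume "a \<le> N" "b \<le> N - a"
    then have "?s a b = (if odd a \<and> odd b then 4 else 0)"
      by (rule sign)
    then show "of_nat (trinomial N a b) * (?s a b * ?m a b) =
        (if odd a \<and> odd b then of_nat (4 * trinomial N a b) * ?m a b else 0)"
      by (simp only:) (simp add: ac_simps)
  qed
  also have "\<dots> = (\<Sum>(a, b)\<in>odd_pairs N. of_nat (4 * trinomial N a b) * ?m a b)"
    by (rule sum.mono_neutral_cong_right) (auto simp: odd_pairs_def)
  finally show ?thesis .
qed

section \<open>Coefficients of F_n\<close>

definition xyz_exp :: "nat \<Rightarrow> nat \<Rightarrow> nat \<Rightarrow> xyz \<Rightarrow>\<^sub>0 nat" where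
  "xyz_exp a b c =
    Poly_Mapping.single Ix a + Poly_Mapping.single Iy b + Poly_Mapping.single Iz c"

lemma xyz_exp_eq_iff: "xyz_exp a b c = xyz_exp a' b' c' \<longleftrightarrow> a = a' \<and> b = b' \<and> c = c'"
proof
  assume eq: "xyz_exp a b c = xyz_exp a' b' c'"
  show "a = a' \<and> b = b' \<and> c = c'"
    using arg_cong[OF eq, of "\<lambda>e. Poly_Mapping.lookup e Ix"]
      arg_cong[OF eq, of "\<lambda>e. Poly_Mapping.lookup e Iy"]
      arg_cong[OF eq, of "\<lambda>e. Poly_Mapping.lookup e Iz"]
    by (simp add: xyz_exp_def lookup_add lookup_single)
qed auto

lemma indet_power:
  "(indet v :: ('v, 'a::comm_semiring_1) mpoly) ^ k = Poly_Mapping.single (Poly_Mapping.single v k) 1"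
proof (induction k)
  case (Suc k)
  then show ?case
    by (simp add: indet_def mult_single flip: single_add)
qed simp

lemma of_nat_mult_monomial:
  "of_nat k * (Xv ^ a * Yv ^ b * Zv ^ c) = Poly_Mapping.single (xyz_exp a b c) (int k)"
  by (simp add: indet_power mult_single xyz_exp_def flip: single_of_nat)

lemma Fpoly_expansion:
  "Fpoly n = (\<Sum>(a, b)\<in>odd_pairs (2 * n + 1). of_nat (4 * trinomial (2 * n + 1) a b) *
    (Xv ^ a * Yv ^ b * Zv ^ (2 * n + 1 - a - b)))"
  unfolding Fpoly_def by (rule four_powers_expansion) simp

lemma finite_odd_pairs: "finite (odd_pairs N)"
  by (rule finite_subset[of _ "{..N} \<times> {..N}"]) (auto simp: odd_pairs_def)

lemma lookup_Fpoly:
  "Poly_Mapping.lookup (Fpoly n) e = (\<Sum>(a, b)\<in>odd_pairs (2 * n + 1).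
    int (4 * trinomial (2 * n + 1) a b) when xyz_exp a b (2 * n + 1 - a - b) = e)"
  unfolding Fpoly_expansion of_nat_mult_monomial lookup_sum
  by (simp add: case_prod_unfold lookup_single)

text \<open>Distinct pairs give distinct exponent vectors, so a single summand of
  \<open>lookup_Fpoly\<close> survives.\<close>

lemma lookup_Fpoly_xyz_exp:
  assumes "(a, b) \<in> odd_pairs (2 * n + 1)"
  shows "Poly_Mapping.lookup (Fpoly n) (xyz_exp a b (2 * n + 1 - a - b)) =
    int (4 * trinomial (2 * n + 1) a b)"
proof -
  have "Poly_Mapping.lookup (Fpoly n) (xyz_exp a b (2 * n + 1 - a - b)) =
    (\<Sum>q\<in>odd_pairs (2 * n + 1). if q = (a, b) then int (4 * trinomial (2 * n + 1) a b) else 0)"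
    unfolding lookup_Fpoly by (intro sum.cong) (auto simp: xyz_exp_eq_iff when_def split: if_splits)
  also have "\<dots> = int (4 * trinomial (2 * n + 1) a b)"
    using assms finite_odd_pairs by simp
  finally show ?thesis .
qed

section \<open>From divisibility of coefficients to phi\<close>

text \<open>The witness \<open>e0\<close> has a nonzero coefficient, so \<open>F\<close> is nonzero
  and the minimum is over a nonempty set. Vanishing coefficients satisfy the divisibility trivially,
  which allows all \<open>e\<close> instead of only the keys.\<close>

lemma phi_eqI:
  assumes "prime p"
    and dvd: "\<And>e. int p ^ k dvd Poly_Mapping.lookup F e"
    and ndvd: "\<not> int p ^ Suc k dvd Poly_Mapping.lookup F e0"
  shows "phi p F = enat k"
proof -
  have e0: "e0 \<in> Poly_Mapping.keys F"
    using ndvd by (auto simp: in_keys_iff)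
  have "multiplicity (int p) (Poly_Mapping.lookup F e0) = k"
    using dvd ndvd by (rule multiplicity_eqI)
  moreover have "k \<le> multiplicity (int p) (Poly_Mapping.lookup F e)" if "e \<in> Poly_Mapping.keys F" for e
    using that assms(1) dvd by (intro multiplicity_geI) (auto simp: in_keys_iff)
  ultimately have "Min ((\<lambda>e. multiplicity (int p) (Poly_Mapping.lookup F e)) ` Poly_Mapping.keys F) = k"
    using e0 by (intro Min_eqI) auto
  then show ?thesis
    using e0 by (auto simp: phi_def)
qed

lemma phi_FpolyI:
  assumes "prime p"
    and dvd: "\<And>a b. (a, b) \<in> odd_pairs (2 * n + 1) \<Longrightarrow> p ^ k dvd 4 * trinomial (2 * n + 1) a b"
    and ab: "(a0, b0) \<in> odd_pairs (2 * n + 1)"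
    and ndvd: "\<not> p ^ Suc k dvd 4 * trinomial (2 * n + 1) a0 b0"
  shows "phi p (Fpoly n) = enat k"
proof (rule phi_eqI)
  show "int p ^ k dvd Poly_Mapping.lookup (Fpoly n) e" for e
    unfolding lookup_Fpoly
  proof (intro dvd_sum, clarify)
    fix a b
    assume "(a, b) \<in> odd_pairs (2 * n + 1)"
    from dvd[OF this] have "int p ^ k dvd int (4 * trinomial (2 * n + 1) a b)"
      by (metis of_nat_dvd_iff of_nat_power)
    then show "int p ^ k dvd
        (int (4 * trinomial (2 * n + 1) a b) when xyz_exp a b (2 * n + 1 - a - b) = e)"
      by (auto simp: when_def)
  qed
  show "\<not> int p ^ Suc k dvd Poly_Mapping.lookup (Fpoly n) (xyz_exp a0 b0 (2 * n + 1 - a0 - b0))"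
    unfolding lookup_Fpoly_xyz_exp[OF ab] using ndvd by (metis of_nat_dvd_iff of_nat_power)
qed fact

section \<open>Divisibility by xyz\<close>

lemma indets_dvd_Fpoly: "Xv * Yv * Zv dvd Fpoly n"
  unfolding Fpoly_expansion
proof (intro dvd_sum, clarify)
  fix a b
  assume "(a, b) \<in> odd_pairs (2 * n + 1)"
  then have "odd a" "odd b" "odd (2 * n + 1 - a - b)"
    by (auto simp: odd_pairs_def)
  then have "Xv dvd Xv ^ a" "Yv dvd Yv ^ b" "Zv dvd Zv ^ (2 * n + 1 - a - b)"
    by (auto intro!: dvd_power odd_pos)
  then show "Xv * Yv * Zv dvd of_nat (4 * trinomial (2 * n + 1) a b) *
      (Xv ^ a * Yv ^ b * Zv ^ (2 * n + 1 - a - b))"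
    by (intro dvd_mult mult_dvd_mono)
qed

section \<open>The prime 2\<close>

text \<open>Binomial absorption, applied to both factors, trades \<open>a * b\<close> for
  \<open>N * (N - 1)\<close>; for \<open>N = 2 * n + 1\<close> this exhibits the factor
  \<open>2 * n\<close>.\<close>

lemma mult_trinomial:
  assumes "a > 0" "b > 0"
  shows "a * b * trinomial N a b = N * (N - 1) * ((N - 2) choose (a - 1)) * ((N - a - 1) choose (b - 1))"
proof -
  have "a * (N choose a) = N * ((N - 1) choose (a - 1))"
    using assms by (simp add: times_binomial_minus1_eq)
  moreover have "b * ((N - a) choose b) = (N - a) * ((N - a - 1) choose (b - 1))"
    using assms by (simp add: times_binomial_minus1_eq)
  \<comment> \<open>The factor \<open>N - a\<close> produced by the second absorption is absorbed
    into the first binomial.\<close>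
  moreover have "(N - a) * ((N - 1) choose (a - 1)) = (N - 1) * ((N - 2) choose (a - 1))"
    using binomial_absorb_comp[of "N - 1" "a - 1"] assms by (simp add: numeral_2_eq_2)
  ultimately show ?thesis
    unfolding trinomial_def by (metis (no_types, opaque_lifting) mult.assoc mult.commute mult.left_commute)
qed

lemma phi_Fpoly_2:
  assumes "n > 0"
  shows "phi 2 (Fpoly n) = enat (multiplicity 2 n + 3)"
proof (rule phi_FpolyI)
  let ?v = "multiplicity 2 n"
  \<comment> \<open>Of the extra exponent 3, two come from the sign factor 4 and one from the 2 in
    \<open>2 * n\<close>.\<close>
  have pow: "2 ^ (?v + 3) = 4 * (2 * 2 ^ ?v :: nat)"
    by (simp add: power_add)
  show "2 ^ (?v + 3) dvd 4 * trinomial (2 * n + 1) a b" if "(a, b) \<in> odd_pairs (2 * n + 1)" for a b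
  proof -
    have "2 ^ ?v dvd n"
      by (rule multiplicity_dvd)
    then have "2 * 2 ^ ?v dvd 2 * n"
      by simp
    also have "2 * n dvd a * b * trinomial (2 * n + 1) a b"
      using that by (subst mult_trinomial) (auto simp: odd_pairs_def odd_pos mult.assoc)
    finally have "2 ^ Suc ?v dvd a * b * trinomial (2 * n + 1) a b"
      by simp
    \<comment> \<open>Since \<open>a\<close> and \<open>b\<close> are odd, they can be
      cancelled.\<close>
    moreover have "coprime (2 ^ Suc ?v) (a * b)"
      using that by (auto simp: odd_pairs_def)
    ultimately have "2 * 2 ^ ?v dvd trinomial (2 * n + 1) a b"
      by (simp only: coprime_dvd_mult_right_iff power_Suc)
    then show ?thesis
      unfolding pow by simp
  qed
  \<comment> \<open>At (1, 1) the coefficient is 4 (2n+1) 2n = 8 n (2n+1); as 2n+1 is odd, the bound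
    is attained.\<close>
  show "(1, 1) \<in> odd_pairs (2 * n + 1)"
    using assms by (simp add: odd_pairs_def)
  show "\<not> 2 ^ Suc (?v + 3) dvd 4 * trinomial (2 * n + 1) 1 1"
  proof
    assume "2 ^ Suc (?v + 3) dvd 4 * trinomial (2 * n + 1) 1 1"
    then have "8 * 2 ^ Suc ?v dvd 8 * ((2 * n + 1) * n)"
      by (simp add: trinomial_def power_add algebra_simps)
    then have "2 ^ Suc ?v dvd (2 * n + 1) * n"
      by (metis nat_mult_dvd_cancel1 zero_less_numeral)
    moreover have "coprime (2 ^ Suc ?v) (2 * n + 1)"
      by (simp only: coprime_power_left_iff) simp
    ultimately have "2 ^ Suc ?v dvd n"
      by (simp only: coprime_dvd_mult_right_iff)
    then show False
      using assms by (simp add: power_dvd_iff_le_multiplicity flip: power_Suc)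
  qed
qed simp

section \<open>Odd primes\<close>

text \<open>By absorption \<open>p ^ m\<close> divides \<open>a\<close> times the binomial
  coefficient. Were the latter prime to \<open>p\<close>, then \<open>p ^ m\<close> would divide the
  smaller positive number \<open>a\<close>.\<close>

lemma prime_dvd_choose_prime_power:
  fixes p :: nat
  assumes "prime p" "0 < a" "a < p ^ m"
  shows "p dvd (p ^ m choose a)"
proof (rule ccontr)
  assume "\<not> p dvd (p ^ m choose a)"
  then have "coprime (p ^ m) (p ^ m choose a)"
    using assms(1) by (simp add: prime_imp_coprime)
  moreover have "p ^ m dvd a * (p ^ m choose a)"
    using assms(2) by (simp add: times_binomial_minus1_eq)
  ultimately have "p ^ m dvd a"
    by (simp add: coprime_dvd_mult_left_iff)
  then show False
    using assms by (auto dest: dvd_imp_le)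
qed

lemma ex_choose_prime_power_not_dvd:
  fixes p :: nat
  assumes "prime p" "N > 0"
  obtains i where "p ^ i \<le> N" "\<not> p dvd (N choose (p ^ i))"
proof -
  obtain u where u: "N = p ^ multiplicity p N * u" "\<not> p dvd u"
    using assms by (metis multiplicity_decompose' not_prime_unit gr_implies_not0)
  let ?i = "multiplicity p N"
  have "u > 0"
    using u assms by (cases u) auto
  have "p ^ ?i \<le> N"
    using assms by (intro dvd_imp_le multiplicity_dvd)
  \<comment> \<open>\<open>const_p_fac\<close>, the counting fact behind Sylow's theorem: this
    binomial coefficient has the same \<open>p\<close>-adic valuation as \<open>u\<close>, which is
    prime to \<open>p\<close>.\<close>
  moreover have "multiplicity p (p ^ ?i * u choose p ^ ?i) = 0"
    using const_p_fac[of u p ?i] u(2) \<open>u > 0\<close> assms by (simp add: not_dvd_imp_multiplicity_0)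
  then have "\<not> p dvd (N choose p ^ ?i)"
    using assms \<open>p ^ ?i \<le> N\<close> prime_multiplicity_gt_zero_iff[of p "N choose p ^ ?i"]
    by (simp flip: u(1))
  ultimately show ?thesis
    by (rule that)
qed

lemma odd_prime_dvd_4_mult:
  fixes p k :: nat
  assumes "prime p" "p \<noteq> 2"
  shows "p ^ i dvd 4 * k \<longleftrightarrow> p ^ i dvd k"
proof -
  have "coprime p (2 * 2)"
    unfolding coprime_mult_right_iff using primes_coprime[OF assms(1) two_is_prime_nat assms(2)] by blast
  then show ?thesis
    by (intro coprime_dvd_mult_right_iff) simp
qed

lemma phi_Fpoly_prime_power:
  fixes p :: nat
  assumes "prime p" "p \<noteq> 2" "m > 0" and N: "2 * n + 1 = p ^ m"
  shows "phi p (Fpoly n) = enat 1"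
proof (rule phi_FpolyI)
  define k where "k = m - 1"
  have m: "m = Suc k"
    using \<open>m > 0\<close> by (simp add: k_def)
  have "p \<ge> 3" "odd p"
    using assms prime_ge_2_nat[of p] prime_odd_nat[of p] by auto
  show "p ^ 1 dvd 4 * trinomial (2 * n + 1) a b" if "(a, b) \<in> odd_pairs (2 * n + 1)" for a b
  proof -
    have "0 < a" "0 < b" "a + b \<le> p ^ m"
      using that N by (auto simp: odd_pairs_def odd_pos)
    then have "p dvd (p ^ m choose a)"
      by (intro prime_dvd_choose_prime_power assms) auto
    then show ?thesis
      unfolding trinomial_def N power_one_right by (intro dvd_mult dvd_mult2)
  qed
  \<comment> \<open>The extremal pair takes both exponents equal to \<open>p ^ (m - 1)\<close>,
    which leaves a nonnegative third exponent.\<close>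
  have "2 * p ^ k \<le> p * p ^ k"
    using \<open>p \<ge> 3\<close> by (intro mult_right_mono) auto
  then have "p ^ k + p ^ k \<le> p ^ m"
    unfolding m power_Suc by linarith
  then show "(p ^ k, p ^ k) \<in> odd_pairs (2 * n + 1)"
    using \<open>odd p\<close> unfolding N by (simp add: odd_pairs_def)
  \<comment> \<open>The two binomial factors have upper entries \<open>p ^ k * p\<close> and
    \<open>p ^ k * (p - 1)\<close>. By \<open>const_p_fac\<close> their valuations are those of
    \<open>p\<close> and \<open>p - 1\<close>, namely 1 and 0.\<close>
  have "\<not> p dvd p - 1"
    using \<open>p \<ge> 3\<close> by (auto dest: dvd_imp_le)
  then have "multiplicity p (p ^ k * (p - 1) choose p ^ k) = 0"
    using \<open>p \<ge> 3\<close> \<open>prime p\<close> by (subst const_p_fac) (auto simp: not_dvd_imp_multiplicity_0)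
  moreover have "p ^ k * (p - 1) = p ^ m - p ^ k"
    by (simp add: m algebra_simps)
  ultimately have "multiplicity p (p ^ m - p ^ k choose p ^ k) = 0"
    by simp
  moreover have "multiplicity p (p ^ m choose p ^ k) = 1"
    using const_p_fac[of p p k] \<open>prime p\<close> \<open>p \<ge> 3\<close> by (simp add: m mult.commute)
  moreover have "p ^ k \<le> p ^ m" "p ^ k \<le> p ^ m - p ^ k"
    using \<open>p ^ k + p ^ k \<le> p ^ m\<close> by linarith+
  ultimately have "trinomial (p ^ m) (p ^ k) (p ^ k) > 0"
    "multiplicity p (trinomial (p ^ m) (p ^ k) (p ^ k)) = 1"
    using \<open>prime p\<close> unfolding trinomial_def
    by (auto simp: prime_elem_multiplicity_mult_distrib)
  then have "\<not> p ^ Suc 1 dvd trinomial (p ^ m) (p ^ k) (p ^ k)"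
    using \<open>prime p\<close> by (subst power_dvd_iff_le_multiplicity) auto
  then show "\<not> p ^ Suc 1 dvd 4 * trinomial (2 * n + 1) (p ^ k) (p ^ k)"
    using odd_prime_dvd_4_mult[OF assms(1,2), of "Suc 1"] by (simp only: N not_False_eq_True)
qed fact

lemma phi_Fpoly_not_prime_power:
  fixes p :: nat
  assumes "prime p" "p \<noteq> 2" "n > 0" and N: "\<And>m. m > 0 \<Longrightarrow> 2 * n + 1 \<noteq> p ^ m"
  shows "phi p (Fpoly n) = enat 0"
proof -
  obtain i where i: "p ^ i \<le> 2 * n + 1" "\<not> p dvd (2 * n + 1 choose (p ^ i))"
    using ex_choose_prime_power_not_dvd[OF \<open>prime p\<close>, of "2 * n + 1"] by auto
  \<comment> \<open>For \<open>i = 0\<close> equality would force \<open>n = 0\<close>; for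
    \<open>i > 0\<close> it contradicts \<open>N\<close>. Hence the remainder is positive and can be
    treated in the same way.\<close>
  have "p ^ i \<noteq> 2 * n + 1"
    using N[of i] \<open>n > 0\<close> by (cases i) auto
  then obtain j where j: "p ^ j \<le> 2 * n + 1 - p ^ i" "\<not> p dvd (2 * n + 1 - p ^ i choose (p ^ j))"
    using ex_choose_prime_power_not_dvd[OF \<open>prime p\<close>, of "2 * n + 1 - p ^ i"] i by auto
  have "odd p"
    using assms prime_ge_2_nat[of p] prime_odd_nat[of p] by auto
  show ?thesis
  proof (rule phi_FpolyI)
    \<comment> \<open>Powers of the odd prime \<open>p\<close> are odd, so this pair really occurs
      in F_n; both of its binomial factors are prime to \<open>p\<close>.\<close>
    show "(p ^ i, p ^ j) \<in> odd_pairs (2 * n + 1)"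
      using i j \<open>odd p\<close> by (simp add: odd_pairs_def)
    have "\<not> p ^ 1 dvd trinomial (2 * n + 1) (p ^ i) (p ^ j)"
      using i j \<open>prime p\<close> by (simp add: trinomial_def prime_dvd_mult_iff)
    then show "\<not> p ^ Suc 0 dvd 4 * trinomial (2 * n + 1) (p ^ i) (p ^ j)"
      using odd_prime_dvd_4_mult[OF assms(1,2), of 1] by (simp only: One_nat_def not_False_eq_True)
  qed (use \<open>prime p\<close> in auto)
qed

section \<open>Combination of the three cases for the prime\<close>

theorem theorem3p5:
  fixes n :: nat
  assumes "n > 0"
  shows "(\<forall>p::nat. prime p \<longrightarrow>
            phi p (Fpoly n) =
              (if p = 2 then enat (multiplicity 2 n + 3)
               else if p > 2 \<and> (\<exists>m::nat. m > 0 \<and> 2 * n + 1 = p ^ m) then 1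
               else 0)) \<and>
         Xv * Yv * Zv dvd Fpoly n"
proof (intro conjI allI impI)
  fix p :: nat
  assume p: "prime p"
  then have "p \<ge> 2"
    by (rule prime_ge_2_nat)
  then consider "p = 2" | m where "p > 2" "m > 0" "2 * n + 1 = p ^ m"
    | "p > 2" "\<And>m. m > 0 \<Longrightarrow> 2 * n + 1 \<noteq> p ^ m"
    using le_neq_implies_less[of 2 p] by metis
  then show "phi p (Fpoly n) =
      (if p = 2 then enat (multiplicity 2 n + 3)
       else if p > 2 \<and> (\<exists>m::nat. m > 0 \<and> 2 * n + 1 = p ^ m) then 1
       else 0)"
  proof cases
    case 1
    then show ?thesis
      using phi_Fpoly_2[OF assms] by simp
  next
    case 2
    then have "phi p (Fpoly n) = 1"
      using phi_Fpoly_prime_power[OF p] by (simp add: one_enat_def)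
    with 2 show ?thesis
      by auto
  next
    case 3
    then have "phi p (Fpoly n) = 0"
      using phi_Fpoly_not_prime_power[OF p _ assms] by (simp add: zero_enat_def)
    with 3 show ?thesis
      by auto
  qed
qed (rule indets_dvd_Fpoly)

end
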